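(* Let $\mathbf{F}_2$ be the free group on the two generators $a,b$. For each of the following words $w_n\in\mathbf{F}_2$ (with integer parameters in the stated ranges), the word map $w_n: SU(2)\times SU(2)\to SU(2)$, $(x,y)\mapsto w_n(x,y)$, is surjective: (a) $w_n=[[a,b],\,a^{n}[a,b]a^{-n}]$, for every $n\geq 1$; (b) $w_n=[[a,b],\,b^{n}[a,b]b^{-n}]$, for every $n\geq 1$; (c) $w_n=[[a,b],\,(ab)^{n}[a,b](ab)^{-n}]$, for every $n\geq 1$; (d) $w_n=[[a,b],\,a^{n}b[a,b]b^{-1}a^{-n}]$, for every $n\geq 2$; (e) $w_n=[[a,b],\,a^{n}b^{2}[a,b]b^{-2}a^{-n}]$, for every $n\geq 1$; (f) $w_n=[[a,b],\,a^{n}b^{m}[a,b]b^{-m}a^{-n}]$, for all $n\geq 2$ and $m\geq 2$ such that $n\equiv 1,2,4,5 \pmod 6$ and $m\equiv 0,2 \pmod 4$; (g) $w_n=[[a,b],\,[a,(ab)^{n}]]$, for every $n\geq 2$.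
   Context: For a group $G$ and a word $w=w(a,b)\in\mathbf{F}_2$, the word map associated with $w$ is the map $w:G\times G\to G$ sending $(x,y)$ to the element $w(x,y)$ obtained by substituting $x$ for $a$ and $y$ for $b$. The commutator convention is $[u,v]=uvu^{-1}v^{-1}$. $SU(2)$ is the group of $2\times 2$ complex unitary matrices of determinant $1$. *)

theory Defs
  imports "HOL-Analysis.Analysis" "HOL-Algebra.Group"
begin

definition commutator :: "('g, 'm) monoid_scheme \<Rightarrow> 'g \<Rightarrow> 'g \<Rightarrow> 'g" where
  "commutator G u v = u \<otimes>\<^bsub>G\<^esub> v \<otimes>\<^bsub>G\<^esub> inv\<^bsub>G\<^esub> u \<otimes>\<^bsub>G\<^esub> inv\<^bsub>G\<^esub> v"

datatype gen2 = Gen_a | Gen_b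

text \<open>A letter is a generator with a sign: \<open>(g, True)\<close> stands for the generator \<open>g\<close> and
  \<open>(g, False)\<close> for its formal inverse.\<close>

type_synonym letter = "gen2 \<times> bool"

definition letter_inv :: "letter \<Rightarrow> letter" where
  "letter_inv l = (fst l, \<not> snd l)"

definition reduced_word :: "letter list \<Rightarrow> bool" where
  "reduced_word w \<longleftrightarrow> successively (\<lambda>l k. k \<noteq> letter_inv l) w"

fun cons_cancel :: "letter \<Rightarrow> letter list \<Rightarrow> letter list" where
  "cons_cancel l [] = [l]"
| "cons_cancel l (k # w) = (if k = letter_inv l then w else l # k # w)"

definition reduce_word :: "letter list \<Rightarrow> letter list" where
  "reduce_word w = foldr cons_cancel w []"

definition F2 :: "letter list monoid" where
  "F2 = \<lparr>carrier = {w. reduced_word w}, mult = (\<lambda>u v. reduce_word (u @ v)), one = []\<rparr>"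

definition a_F2 :: "letter list" where "a_F2 = [(Gen_a, True)]"
definition b_F2 :: "letter list" where "b_F2 = [(Gen_b, True)]"

fun letter_eval :: "('g, 'm) monoid_scheme \<Rightarrow> 'g \<Rightarrow> 'g \<Rightarrow> letter \<Rightarrow> 'g" where
  "letter_eval G x y (Gen_a, True) = x"
| "letter_eval G x y (Gen_a, False) = inv\<^bsub>G\<^esub> x"
| "letter_eval G x y (Gen_b, True) = y"
| "letter_eval G x y (Gen_b, False) = inv\<^bsub>G\<^esub> y"

definition word_map :: "('g, 'm) monoid_scheme \<Rightarrow> letter list \<Rightarrow> 'g \<times> 'g \<Rightarrow> 'g" where
  "word_map G w = (\<lambda>(x, y). foldr (\<lambda>l g. letter_eval G x y l \<otimes>\<^bsub>G\<^esub> g) w \<one>\<^bsub>G\<^esub>)"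

definition word_map_surjective :: "('g, 'm) monoid_scheme \<Rightarrow> letter list \<Rightarrow> bool" where
  "word_map_surjective G w \<longleftrightarrow> word_map G w ` (carrier G \<times> carrier G) = carrier G"

definition conj_transpose :: "complex ^ 'n ^ 'm \<Rightarrow> complex ^ 'm ^ 'n" where
  "conj_transpose A = (\<chi> i j. cnj (A $ j $ i))"

definition unitary_matrix :: "complex ^ 'n ^ 'n \<Rightarrow> bool" where
  "unitary_matrix A \<longleftrightarrow> conj_transpose A ** A = mat 1 \<and> A ** conj_transpose A = mat 1"

definition SU2 :: "(complex ^ 2 ^ 2) monoid" where
  "SU2 = \<lparr>carrier = {A. unitary_matrix A \<and> det A = 1}, mult = (**), one = mat 1\<rparr>"

lemma letter_inv_letter_inv [simp]: "letter_inv (letter_inv l) = l"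
  by (simp add: letter_inv_def)

lemma letter_inv_neq [simp]: "letter_inv l \<noteq> l" "l \<noteq> letter_inv l"
  by (simp_all add: letter_inv_def prod_eq_iff)

lemma reduced_Nil [simp]: "reduced_word []"
  by (simp add: reduced_word_def)

lemma reduced_single [simp]: "reduced_word [l]"
  by (simp add: reduced_word_def)

lemma reduced_Cons_Cons [simp]:
  "reduced_word (l # k # w) \<longleftrightarrow> k \<noteq> letter_inv l \<and> reduced_word (k # w)"
  by (simp add: reduced_word_def)

lemma reduced_ConsD: "reduced_word (l # w) \<Longrightarrow> reduced_word w"
  by (cases w) auto

lemma reduced_cons_cancel: "reduced_word w \<Longrightarrow> reduced_word (cons_cancel l w)"
  by (cases w) (auto dest: reduced_ConsD)

lemma cons_cancel_reduced: "reduced_word (l # w) \<Longrightarrow> cons_cancel l w = l # w"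
  by (cases w) auto

lemma cons_cancel_inv:
  assumes "reduced_word w"
  shows "cons_cancel l (cons_cancel (letter_inv l) w) = w"
proof (cases w)
  case (Cons k v)
  then show ?thesis using assms by (cases v) auto
qed auto

lemma reduced_foldr: "reduced_word v \<Longrightarrow> reduced_word (foldr cons_cancel u v)"
  by (induction u) (auto intro: reduced_cons_cancel)

lemma reduced_reduce [simp]: "reduced_word (reduce_word w)"
  by (simp add: reduce_word_def reduced_foldr)

lemma reduce_reduced: "reduced_word w \<Longrightarrow> reduce_word w = w"
proof (induction w)
  case (Cons l w)
  then have "reduce_word w = w" by (blast dest: reduced_ConsD)
  then show ?case using cons_cancel_reduced[OF Cons.prems] by (simp add: reduce_word_def)
qed (simp add: reduce_word_def)

lemma reduce_append: "reduce_word (u @ v) = foldr cons_cancel u (reduce_word v)"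
  by (simp add: reduce_word_def)

lemma foldr_cons_cancel:
  assumes "reduced_word w"
  shows "foldr cons_cancel (cons_cancel l r) w = cons_cancel l (foldr cons_cancel r w)"
proof (cases r)
  case (Cons k v)
  have "reduced_word (foldr cons_cancel v w)" using assms by (rule reduced_foldr)
  then show ?thesis using Cons by (auto simp: cons_cancel_inv)
qed auto

lemma foldr_reduce: "reduced_word w \<Longrightarrow> foldr cons_cancel (reduce_word u) w = foldr cons_cancel u w"
proof (induction u)
  case (Cons l u)
  have "foldr cons_cancel (reduce_word (l # u)) w = foldr cons_cancel (cons_cancel l (reduce_word u)) w"
    by (simp add: reduce_word_def)
  then show ?case using Cons by (simp add: foldr_cons_cancel)
qed (simp add: reduce_word_def)

lemma reduce_rev_inv: "reduce_word (map letter_inv (rev w) @ w) = []"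
proof (induction w)
  case (Cons l w)
  have "cons_cancel (letter_inv l) (cons_cancel l (reduce_word w)) = reduce_word w"
    using cons_cancel_inv[of "reduce_word w" "letter_inv l"] by simp
  then have "reduce_word (map letter_inv (rev (l # w)) @ l # w) = reduce_word (map letter_inv (rev w) @ w)"
    by (simp add: reduce_word_def)
  then show ?case using Cons by simp
qed (simp add: reduce_word_def)

lemma group_F2: "group F2"
proof (rule groupI)
  fix x y z assume "x \<in> carrier F2" "y \<in> carrier F2" "z \<in> carrier F2"
  then show "x \<otimes>\<^bsub>F2\<^esub> y \<otimes>\<^bsub>F2\<^esub> z = x \<otimes>\<^bsub>F2\<^esub> (y \<otimes>\<^bsub>F2\<^esub> z)"
    using foldr_reduce[of z "x @ y"] by (simp add: F2_def reduce_append reduce_reduced reduced_foldr)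
next
  fix x assume x: "x \<in> carrier F2"
  have "reduce_word (reduce_word (map letter_inv (rev x)) @ x) = []"
    using foldr_reduce[of "reduce_word x" "map letter_inv (rev x)"] reduce_rev_inv[of x]
    by (simp add: reduce_append)
  then show "\<exists>y\<in>carrier F2. y \<otimes>\<^bsub>F2\<^esub> x = \<one>\<^bsub>F2\<^esub>"
    by (intro bexI[of _ "reduce_word (map letter_inv (rev x))"]) (simp_all add: F2_def)
qed (auto simp: F2_def reduce_reduced)

lemma a_F2_in_carrier: "a_F2 \<in> carrier F2"
  by (simp add: F2_def a_F2_def)

lemma b_F2_in_carrier: "b_F2 \<in> carrier F2"
  by (simp add: F2_def b_F2_def)

context
  fixes G (structure) and x y
  assumes G: "group G" and x: "x \<in> carrier G" and y: "y \<in> carrier G"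
begin

interpretation group G by (rule G)

lemma letter_eval_closed: "letter_eval G x y l \<in> carrier G"
  by (cases "(G, x, y, l)" rule: letter_eval.cases) (use x y in auto)

lemma letter_eval_letter_inv: "letter_eval G x y (letter_inv l) = inv (letter_eval G x y l)"
  by (cases "(G, x, y, l)" rule: letter_eval.cases) (use x y in \<open>auto simp: letter_inv_def\<close>)

lemma word_map_Nil: "word_map G [] (x, y) = \<one>"
  by (simp add: word_map_def)

lemma word_map_Cons: "word_map G (l # w) (x, y) = letter_eval G x y l \<otimes> word_map G w (x, y)"
  by (simp add: word_map_def)

lemma word_map_closed: "word_map G w (x, y) \<in> carrier G"
  by (induction w) (auto simp: word_map_Nil word_map_Cons letter_eval_closed)

lemma word_map_append: "word_map G (u @ v) (x, y) = word_map G u (x, y) \<otimes> word_map G v (x, y)"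
  by (induction u)
    (auto simp: word_map_Nil word_map_Cons letter_eval_closed word_map_closed m_assoc)

lemma word_map_cons_cancel: "word_map G (cons_cancel l w) (x, y) = word_map G (l # w) (x, y)"
  by (cases w)
    (auto simp: word_map_Nil word_map_Cons letter_eval_closed letter_eval_letter_inv
      word_map_closed m_assoc [symmetric])

lemma word_map_reduce: "word_map G (reduce_word w) (x, y) = word_map G w (x, y)"
proof (induction w)
  case (Cons l w)
  have "word_map G (reduce_word (l # w)) (x, y) = word_map G (l # reduce_word w) (x, y)"
    unfolding word_map_cons_cancel[symmetric] by (simp add: reduce_word_def)
  then show ?case using Cons by (simp add: word_map_Cons)
qed (simp add: reduce_word_def)

lemma word_map_hom: "(\<lambda>w. word_map G w (x, y)) \<in> hom F2 G"
  by (rule homI) (auto simp: word_map_closed F2_def word_map_reduce word_map_append)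

lemma word_map_a_F2: "word_map G a_F2 (x, y) = x"
  using x by (simp add: a_F2_def word_map_def)

lemma word_map_b_F2: "word_map G b_F2 (x, y) = y"
  using y by (simp add: b_F2_def word_map_def)

end

lemma conj_transpose_conj_transpose [simp]: "conj_transpose (conj_transpose A) = A"
  by (simp add: conj_transpose_def vec_eq_iff)

lemma conj_transpose_mat_1 [simp]: "conj_transpose (mat 1) = mat 1"
  by (auto simp: conj_transpose_def mat_def vec_eq_iff)

lemma conj_transpose_mult: "conj_transpose (A ** B) = conj_transpose B ** conj_transpose A"
  by (simp add: conj_transpose_def matrix_matrix_mult_def vec_eq_iff mult.commute)

lemma unitary_matrix_mult:
  assumes "unitary_matrix A" "unitary_matrix B"
  shows "unitary_matrix (A ** B)"
proof -
  have "conj_transpose B ** conj_transpose A ** (A ** B)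
      = conj_transpose B ** (conj_transpose A ** A) ** B"
    and "A ** B ** (conj_transpose B ** conj_transpose A)
      = A ** (B ** conj_transpose B) ** conj_transpose A"
    by (simp_all add: matrix_mul_assoc)
  then show ?thesis using assms by (simp add: unitary_matrix_def conj_transpose_mult)
qed

lemma det_unitary_conj_transpose:
  assumes "unitary_matrix A" "det A = 1"
  shows "det (conj_transpose A) = 1"
  using assms det_mul[of "conj_transpose A" A] by (simp add: unitary_matrix_def)

lemma group_SU2: "group SU2"
proof (rule groupI)
  fix A assume "A \<in> carrier SU2"
  then have "conj_transpose A \<in> carrier SU2" "conj_transpose A \<otimes>\<^bsub>SU2\<^esub> A = \<one>\<^bsub>SU2\<^esub>"
    by (auto simp: SU2_def unitary_matrix_def det_unitary_conj_transpose)
  then show "\<exists>B\<in>carrier SU2. B \<otimes>\<^bsub>SU2\<^esub> A = \<one>\<^bsub>SU2\<^esub>" by blast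
qed (auto simp: SU2_def unitary_matrix_mult det_mul matrix_mul_assoc, simp add: unitary_matrix_def)

lemma inv_SU2: "A \<in> carrier SU2 \<Longrightarrow> inv\<^bsub>SU2\<^esub> A = conj_transpose A"
  by (rule group.inv_equality[OF group_SU2])
    (auto simp: SU2_def unitary_matrix_def det_unitary_conj_transpose)

end

theory Submission
  imports Defs
begin

text \<open>
  The image of a word map on \<open>SU(2)\<close> is closed under conjugation, and two elements of \<open>SU(2)\<close> are
  conjugate as soon as their traces agree. Since \<open>SU(2) \<times> SU(2)\<close> is connected, the traces of the image
  form an interval, which contains the trace of the identity. Hence a word map is surjective once it
  attains \<open>-1\<close> (lemma \<open>word_map_surjective_if_minus_one\<close>).

  Identify \<open>SU(2)\<close> with the unit quaternions. A commutator \<open>[c, d]\<close> equals \<open>-1\<close> exactly when \<open>c\<close> and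
  \<open>d\<close> are orthogonal purely imaginary quaternions. Take \<open>X\<close> diagonal with eigenvalue angle \<open>\<theta>\<close> and
  \<open>C = [X, Y]\<close>. Then \<open>Re C = 1 - 2 (q sin \<theta>)\<^sup>2\<close>, where \<open>q\<close> is the modulus of the off-diagonal entry of
  \<open>Y\<close>, so \<open>C\<close> is imaginary when \<open>(q sin \<theta>)\<^sup>2 = 1/2\<close>. In that case \<open>C\<close> has component \<open>cot \<theta>\<close> along the
  axis of \<open>X\<close>, and conjugation by \<open>X\<^sup>n\<close> rotates about this axis by \<open>2n\<theta>\<close>. So \<open>C\<close> is orthogonal to
  its conjugate by \<open>X\<^sup>n\<close> when \<open>(cos \<theta>)\<^sup>2 = cos 2\<theta> cos 2n\<theta>\<close>
  (lemma \<open>commutator_diag_conj_eq_minus_one\<close>). The diagonal entry of \<open>Y\<close> is constrained in modulus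
  only, which leaves the trace of \<open>Y\<close> to be chosen. Two choices handle all words:

  \<^item> \<open>Y\<^sup>2 = -1\<close> (lemma \<open>exists_pair_square_minus_one\<close>). Powers of \<open>Y\<close> are then central up to a factor
    \<open>Y\<close>, so they can be inserted in the conjugating element. Together with the automorphisms of the
    free group that carry \<open>[a, b]\<close> to itself or to its inverse while turning \<open>a\<close> into \<open>b\<close> or \<open>ab\<close>, this
    gives (a)-(f). For (d) one takes \<open>a\<^sup>2 = -1\<close>, so that \<open>a\<^sup>nb\<close> is \<open>\<plusminus>b\<close> or \<open>\<plusminus>ab\<close>, and exponent \<open>1\<close> in
    the lemma.

  \<^item> \<open>Y\<^sup>n\<^sup>+\<^sup>1 = \<plusminus>1\<close> and \<open>\<theta> = \<pi>/3\<close>, the solution of the equation for exponent \<open>1\<close>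
    (lemma \<open>exists_pair_power_central\<close>). With \<open>ab = Y\<close> and \<open>b = X\<close> the second entry \<open>[a, (ab)\<^sup>n]\<close> of (g)
    collapses to \<open>[a, (ab)\<^sup>-\<^sup>1] = b\<^sup>-\<^sup>1 [X, Y] b\<close>, a conjugate of the inverse of \<open>[a, b]\<close>.
\<close>

section \<open>Commutators and central involutions\<close>

context group
begin

lemma cancel_inv_left [simp]:
  "\<lbrakk>x \<in> carrier G; y \<in> carrier G\<rbrakk> \<Longrightarrow> inv x \<otimes> (x \<otimes> y) = y"
  by (simp add: m_assoc [symmetric])

lemma cancel_inv_right [simp]:
  "\<lbrakk>x \<in> carrier G; y \<in> carrier G\<rbrakk> \<Longrightarrow> x \<otimes> (inv x \<otimes> y) = y"
  by (simp add: m_assoc [symmetric])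

lemma commutator_closed [simp]:
  "\<lbrakk>x \<in> carrier G; y \<in> carrier G\<rbrakk> \<Longrightarrow> commutator G x y \<in> carrier G"
  by (simp add: commutator_def)

lemma commutator_eq_iff:
  assumes "x \<in> carrier G" "y \<in> carrier G" "e \<in> carrier G"
  shows "commutator G x y = e \<longleftrightarrow> x \<otimes> y = e \<otimes> (y \<otimes> x)"
proof -
  have "commutator G x y = (x \<otimes> y) \<otimes> inv (y \<otimes> x)"
    using assms by (simp add: commutator_def inv_mult_group m_assoc)
  then show ?thesis using assms by (simp add: inv_solve_right')
qed

lemma commutator_conj:
  assumes "x \<in> carrier G" "y \<in> carrier G" "g \<in> carrier G"
  shows "commutator G (g \<otimes> x \<otimes> inv g) (g \<otimes> y \<otimes> inv g) = g \<otimes> commutator G x y \<otimes> inv g"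
  using assms by (simp add: commutator_def inv_mult_group m_assoc)

lemma inv_commutator:
  assumes "x \<in> carrier G" "y \<in> carrier G"
  shows "inv (commutator G x y) = commutator G y x"
  using assms by (simp add: commutator_def inv_mult_group m_assoc)

text \<open>Substituting \<open>a = y\<^sup>-\<^sup>1\<close> and \<open>b = yx\<close>, for which \<open>ab = x\<close>, does not change the commutator; this
  reduces words that conjugate by powers of \<open>ab\<close> to words that conjugate by powers of \<open>a\<close>.\<close>

lemma commutator_inv_mult: "\<lbrakk>x \<in> carrier G; y \<in> carrier G\<rbrakk> \<Longrightarrow> commutator G (inv y) (y \<otimes> x) = commutator G x y"
  by (simp add: commutator_def inv_mult_group m_assoc)

definition central :: "'a \<Rightarrow> bool" where
  "central z \<longleftrightarrow> z \<in> carrier G \<and> (\<forall>x\<in>carrier G. x \<otimes> z = z \<otimes> x)"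

lemma conj_mult_central:
  assumes z: "central z" and xg: "x \<in> carrier G" "g \<in> carrier G"
  shows "z \<otimes> g \<otimes> x \<otimes> inv (z \<otimes> g) = g \<otimes> x \<otimes> inv g"
proof -
  have zG: "z \<in> carrier G" and comm: "\<And>y. y \<in> carrier G \<Longrightarrow> z \<otimes> y = y \<otimes> z"
    using z by (auto simp: central_def)
  have "z \<otimes> g \<otimes> x \<otimes> inv (z \<otimes> g) = z \<otimes> (g \<otimes> x \<otimes> inv g) \<otimes> inv z"
    using zG xg by (simp add: m_assoc inv_mult_group)
  also have "\<dots> = (g \<otimes> x \<otimes> inv g) \<otimes> z \<otimes> inv z" using comm xg by simp
  finally show ?thesis using zG xg by (simp add: m_assoc)
qed

lemma commutator_mult_central:
  assumes z: "central z" and xy: "x \<in> carrier G" "y \<in> carrier G"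
  shows "commutator G x (z \<otimes> y) = commutator G x y"
proof -
  have zG: "z \<in> carrier G" and comm: "x \<otimes> z = z \<otimes> x"
    using z xy by (auto simp: central_def)
  have "commutator G x (z \<otimes> y) = (x \<otimes> z) \<otimes> y \<otimes> inv x \<otimes> inv y \<otimes> inv z"
    using zG xy by (simp add: commutator_def m_assoc inv_mult_group)
  also have "\<dots> = z \<otimes> commutator G x y \<otimes> inv z"
    unfolding comm using zG xy by (simp add: commutator_def m_assoc)
  also have "\<dots> = commutator G x y \<otimes> z \<otimes> inv z"
    using z xy by (simp add: central_def)
  finally show ?thesis using zG xy by (simp add: m_assoc)
qed

text \<open>The role of \<open>e\<close> below is played by \<open>-1\<close>: the condition \<open>[x, y] = e\<close> says that \<open>x\<close> and \<open>y\<close>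
  anticommute, and this relation is symmetric and survives inverting either element.\<close>

definition central_involution :: "'a \<Rightarrow> bool" where
  "central_involution e \<longleftrightarrow> central e \<and> e \<otimes> e = \<one>"

context
  fixes e
  assumes e: "central_involution e"
begin

lemma involution_carrier [simp]: "e \<in> carrier G"
  using e by (simp add: central_involution_def central_def)

lemma involution_square [simp]: "e \<otimes> e = \<one>"
  using e by (simp add: central_involution_def)

lemma involution_comm: "x \<in> carrier G \<Longrightarrow> x \<otimes> e = e \<otimes> x"
  using e by (simp add: central_involution_def central_def)

lemma involution_inv [simp]: "inv e = e"
  by (intro inv_equality) simp_all

lemma central_one_involution: "z \<in> {\<one>, e} \<Longrightarrow> central z"
  by (auto simp: central_def intro: involution_comm)

lemma involution_int_pow: "e [^] (k::int) \<in> {\<one>, e}"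
proof -
  have pow: "e [^] n \<in> {\<one>, e}" for n :: nat
    by (induction n) auto
  then have "inv (e [^] n) \<in> {\<one>, e}" for n :: nat
    by (metis insert_iff singletonD inv_one involution_inv)
  with pow show ?thesis by (simp only: int_pow_def2 split: if_split) blast
qed

lemma even_int_pow_square_involution:
  assumes "x \<in> carrier G" "x \<otimes> x = e" "even (k::int)"
  shows "x [^] k \<in> {\<one>, e}"
proof -
  obtain m where "k = 2 * m" using \<open>even k\<close> by (rule evenE)
  moreover have "x [^] (2::int) = e"
    using assms int_pow_mult[of x 1 1] by simp
  ultimately have "x [^] k = e [^] m"
    using int_pow_pow[of x 2 m] assms by simp
  then show ?thesis using involution_int_pow by simp
qed

lemma commutator_swap_involution:
  assumes "x \<in> carrier G" "y \<in> carrier G" "commutator G x y = e"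
  shows "commutator G y x = e"
  using inv_commutator[of x y] assms by simp

lemma commutator_inv_involution:
  assumes xy: "x \<in> carrier G" "y \<in> carrier G" and c: "commutator G x y = e"
  shows "commutator G (inv x) y = e"
proof -
  have "commutator G (inv x) y = inv x \<otimes> commutator G y x \<otimes> x"
    using xy by (simp add: commutator_def m_assoc)
  also have "\<dots> = e \<otimes> inv x \<otimes> x"
    using commutator_swap_involution[OF xy c] involution_comm[of "inv x"] xy by simp
  finally show ?thesis using xy by (simp add: m_assoc)
qed

lemma commutator_conj_inv_involution:
  assumes "c \<in> carrier G" "g \<in> carrier G" and "commutator G c (g \<otimes> c \<otimes> inv g) = e"
  shows "commutator G (inv c) (g \<otimes> inv c \<otimes> inv g) = e"
proof -
  let ?d = "g \<otimes> c \<otimes> inv g"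
  have d: "?d \<in> carrier G" "inv c \<in> carrier G" "inv ?d \<in> carrier G" using assms by auto
  have "commutator G (inv c) ?d = e" by (rule commutator_inv_involution) fact+
  then have "commutator G ?d (inv c) = e" by (rule commutator_swap_involution[OF d(2,1)])
  then have "commutator G (inv ?d) (inv c) = e" by (rule commutator_inv_involution[OF d(1,2)])
  then have "commutator G (inv c) (inv ?d) = e" by (rule commutator_swap_involution[OF d(3,2)])
  moreover have "inv ?d = g \<otimes> inv c \<otimes> inv g"
    using assms by (simp add: inv_mult_group m_assoc)
  ultimately show ?thesis by simp
qed

text \<open>Conjugating by \<open>g\<^sup>-\<^sup>1\<close> shows that \<open>c\<close> anticommutes with \<open>g\<^sup>-\<^sup>1 c g\<close> too.\<close>

lemma commutator_inv_conj_involution: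
  assumes "c \<in> carrier G" "g \<in> carrier G" and c: "commutator G c (g \<otimes> c \<otimes> inv g) = e"
  shows "commutator G (inv c) (inv g \<otimes> c \<otimes> g) = e"
proof -
  have "commutator G (inv g \<otimes> c \<otimes> inv (inv g)) (inv g \<otimes> (g \<otimes> c \<otimes> inv g) \<otimes> inv (inv g)) = inv g \<otimes> e \<otimes> inv (inv g)"
    using assms by (subst commutator_conj) auto
  also have "\<dots> = e"
    using involution_comm[of "inv g"] assms by (simp add: m_assoc)
  finally have "commutator G (inv g \<otimes> c \<otimes> g) c = e"
    using assms by (simp add: m_assoc)
  then have "commutator G c (inv g \<otimes> c \<otimes> g) = e"
    using assms by (intro commutator_swap_involution[of "inv g \<otimes> c \<otimes> g" c]) auto
  then show ?thesis using assms by (intro commutator_inv_involution) auto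
qed

end

end

section \<open>Evaluating words of the free group\<close>

context
  fixes G (structure) and x y
  assumes G: "group G" and x: "x \<in> carrier G" and y: "y \<in> carrier G"
begin

interpretation group G by (rule G)

lemma word_map_mult_F2:
  assumes "u \<in> carrier F2" "v \<in> carrier F2"
  shows "word_map G (u \<otimes>\<^bsub>F2\<^esub> v) (x, y) = word_map G u (x, y) \<otimes> word_map G v (x, y)"
  using word_map_hom[OF G x y] assms by (simp add: hom_def)

lemma group_hom_word_map: "group_hom F2 G (\<lambda>w. word_map G w (x, y))"
  by (simp add: group_hom_def group_hom_axioms_def group_F2 G word_map_hom[OF G x y])

lemma word_map_inv_F2:
  "u \<in> carrier F2 \<Longrightarrow> word_map G (inv\<^bsub>F2\<^esub> u) (x, y) = inv (word_map G u (x, y))"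
  using group_hom.hom_inv[OF group_hom_word_map] by simp

lemma word_map_int_pow_F2:
  "u \<in> carrier F2 \<Longrightarrow> word_map G (u [^]\<^bsub>F2\<^esub> (k::int)) (x, y) = word_map G u (x, y) [^] k"
  using group_hom.hom_int_pow[OF group_hom_word_map] by simp

lemma word_map_commutator_F2:
  assumes "u \<in> carrier F2" "v \<in> carrier F2"
  shows "word_map G (commutator F2 u v) (x, y) =
    commutator G (word_map G u (x, y)) (word_map G v (x, y))"
  using assms group_F2
  by (simp add: commutator_def word_map_mult_F2 word_map_inv_F2 group.inv_closed
      monoid.m_closed[OF group.is_monoid])

lemma word_map_conj:
  assumes g: "g \<in> carrier G"
  shows "word_map G w (g \<otimes> x \<otimes> inv g, g \<otimes> y \<otimes> inv g) = g \<otimes> word_map G w (x, y) \<otimes> inv g"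
proof (induction w)
  case Nil
  then show ?case using g by (simp add: word_map_def)
next
  case (Cons l w)
  have "letter_eval G (g \<otimes> x \<otimes> inv g) (g \<otimes> y \<otimes> inv g) l = g \<otimes> letter_eval G x y l \<otimes> inv g"
    using x y g by (cases "(G, x, y, l)" rule: letter_eval.cases)
      (auto simp: inv_mult_group m_assoc)
  moreover have "letter_eval G x y l \<in> carrier G" "word_map G w (x, y) \<in> carrier G"
    using letter_eval_closed[OF G x y] word_map_closed[OF G x y] by auto
  ultimately show ?case using Cons g x y
    by (simp add: word_map_Cons[OF G] m_assoc)
qed

end

section \<open>The special unitary group as the unit quaternions\<close>

text \<open>The quaternion \<open>p + q j\<close> with complex \<open>p\<close>, \<open>q\<close>; the real part of \<open>p\<close> is half the trace.\<close>

definition quat :: "complex \<Rightarrow> complex \<Rightarrow> complex ^ 2 ^ 2" where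
  "quat p q = vector [vector [p, q], vector [- cnj q, cnj p]]"

lemma quat_nth [simp]:
  "quat p q $ 1 $ 1 = p" "quat p q $ 1 $ 2 = q" "quat p q $ 2 $ 1 = - cnj q" "quat p q $ 2 $ 2 = cnj p"
  by (simp_all add: quat_def)

lemma quat_eq_iff: "quat p q = quat r s \<longleftrightarrow> p = r \<and> q = s"
  by (auto simp: vec_eq_iff forall_2)

lemma quat_mult: "quat p q ** quat r s = quat (p * r - q * cnj s) (p * s + q * cnj r)"
  by (simp add: vec_eq_iff forall_2 matrix_matrix_mult_def sum_2 algebra_simps)

lemma quat_one: "mat 1 = quat 1 0"
  by (simp add: vec_eq_iff forall_2 mat_def)

lemma conj_transpose_quat: "conj_transpose (quat p q) = quat (cnj p) (- q)"
  by (simp add: vec_eq_iff forall_2 conj_transpose_def)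

lemma quat_in_SU2: "quat p q \<in> carrier SU2 \<longleftrightarrow> (cmod p)\<^sup>2 + (cmod q)\<^sup>2 = 1"
proof -
  have "p * cnj p + q * cnj q = 1 \<longleftrightarrow> (cmod p)\<^sup>2 + (cmod q)\<^sup>2 = 1"
    using of_real_eq_1_iff[of "(cmod p)\<^sup>2 + (cmod q)\<^sup>2", where 'a = complex]
    by (simp only: of_real_add complex_norm_square)
  then show ?thesis
    by (auto simp: SU2_def unitary_matrix_def conj_transpose_quat quat_mult quat_one quat_eq_iff det_2
        algebra_simps)
qed

lemma SU2_quatE:
  assumes "A \<in> carrier SU2"
  obtains p q where "A = quat p q" "(cmod p)\<^sup>2 + (cmod q)\<^sup>2 = 1"
proof -
  define p q r s where "p = A $ 1 $ 1" and "q = A $ 1 $ 2" and "r = A $ 2 $ 1" and "s = A $ 2 $ 2"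
  note d = p_def q_def r_def s_def
  have "conj_transpose A ** A = mat 1" "A ** conj_transpose A = mat 1" and D: "p * s - q * r = 1"
    using assms by (auto simp: SU2_def unitary_matrix_def det_2 d)
  then have E: "cnj p * p + cnj r * r = 1" "cnj p * q + cnj r * s = 0"
    and F: "p * cnj p + q * cnj q = 1" "p * cnj r + q * cnj s = 0"
    by (simp_all add: vec_eq_iff forall_2 matrix_matrix_mult_def sum_2 conj_transpose_def mat_def d)
  \<comment> \<open>The adjoint of \<open>A\<close> is its inverse, which by \<open>det A = 1\<close> is the adjugate; compare entries.\<close>
  have "s * (cnj p * p + cnj r * r) = cnj p * (p * s - q * r) + r * (cnj p * q + cnj r * s)"
    by (simp add: algebra_simps)
  then have "s = cnj p" using D E by simp
  have "cnj p * r + cnj q * s = 0"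
    using arg_cong[OF F(2), of cnj] by simp
  moreover have "r * (p * cnj p + q * cnj q) = - cnj q * (p * s - q * r) + p * (cnj p * r + cnj q * s)"
    by (simp add: algebra_simps)
  ultimately have "r = - cnj q" using D F(1) by simp
  with \<open>s = cnj p\<close> have "A = quat p q" by (simp add: vec_eq_iff forall_2 d)
  then show thesis using that assms quat_in_SU2 by blast
qed

interpretation SU2: group SU2 by (rule group_SU2)

lemma SU2_simps [simp]: "x \<otimes>\<^bsub>SU2\<^esub> y = x ** y" "\<one>\<^bsub>SU2\<^esub> = mat 1"
  by (simp_all add: SU2_def)

lemma inv_quat [simp]:
  "(cmod p)\<^sup>2 + (cmod q)\<^sup>2 = 1 \<Longrightarrow> inv\<^bsub>SU2\<^esub> (quat p q) = quat (cnj p) (- q)"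
  by (simp add: inv_SU2 quat_in_SU2 conj_transpose_quat)

lemma central_involution_minus_one: "SU2.central_involution (quat (-1) 0)"
proof -
  have "A ** quat (-1) 0 = quat (-1) 0 ** A" if "A \<in> carrier SU2" for A
    using that by (rule SU2_quatE) (simp add: quat_mult)
  then show ?thesis
    unfolding SU2.central_involution_def SU2.central_def
    by (simp add: quat_in_SU2 quat_mult quat_one)
qed

section \<open>Word maps that attain minus one are surjective\<close>

text \<open>The eigenvalues have product \<open>1\<close> and sum equal to the trace. The diagonal form picks the
  eigenvalue with nonnegative imaginary part first, so that it is a function of the trace.\<close>

lemma SU2_diagonalize:
  assumes "A \<in> carrier SU2"
  obtains U where "U \<in> carrier SU2"
    "A = U \<otimes>\<^bsub>SU2\<^esub> quat (Complex (Re (A $ 1 $ 1)) (sqrt (1 - (Re (A $ 1 $ 1))\<^sup>2))) 0 \<otimes>\<^bsub>SU2\<^esub> inv\<^bsub>SU2\<^esub> U"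
proof -
  obtain p q where A: "A = quat p q" and n: "(cmod p)\<^sup>2 + (cmod q)\<^sup>2 = 1"
    using assms by (rule SU2_quatE)
  define \<sigma> where "\<sigma> = sqrt (1 - (Re p)\<^sup>2)"
  define z where "z = Complex (Re p) \<sigma>"
  define d where "d = \<sigma> - Im p"
  define N where "N = sqrt ((cmod q)\<^sup>2 + d\<^sup>2)"
  have sq: "1 - (Re p)\<^sup>2 = (Im p)\<^sup>2 + (cmod q)\<^sup>2" using n by (simp add: cmod_power2)
  then have \<sigma>2: "\<sigma>\<^sup>2 = (Im p)\<^sup>2 + (cmod q)\<^sup>2" by (simp add: \<sigma>_def)
  show thesis
  proof (cases "N = 0")
    case True
    then have "q = 0" "\<sigma> = Im p" unfolding N_def d_def by (simp_all add: add_nonneg_eq_0_iff)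
    then have "A = quat z 0" by (simp add: A z_def)
    then show thesis using that[of "mat 1"] SU2.one_closed SU2.inv_one
      by (simp add: A z_def \<sigma>_def)
  next
    case False
    then have "N > 0" and N2: "N\<^sup>2 = (cmod q)\<^sup>2 + d\<^sup>2" by (simp_all add: N_def less_le)
    \<comment> \<open>The first column of \<open>U\<close> is the unit vector along \<open>(q, z - p)\<close>, an eigenvector for \<open>z\<close>.\<close>
    define U where "U = quat (q / N) (\<i> * d / N)"
    have UG: "U \<in> carrier SU2"
      unfolding U_def quat_in_SU2
      using \<open>N > 0\<close> by (simp add: norm_divide norm_mult power_divide add_divide_distrib[symmetric] N2[symmetric])
    have e1: "p * q - q * (- \<i> * d) = q * z"
      by (simp add: complex_eq_iff d_def z_def algebra_simps)
    have "(cmod q)\<^sup>2 = \<sigma>\<^sup>2 - (Im p)\<^sup>2" using \<sigma>2 by simp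
    then have "q * cnj q = of_real (\<sigma>\<^sup>2 - (Im p)\<^sup>2)" by (metis complex_norm_square)
    then have e2: "p * (\<i> * d) + q * cnj q = \<i> * d * cnj z"
      by (simp add: complex_eq_iff d_def z_def algebra_simps power2_eq_square)
    have "A ** U = U ** quat z 0"
      unfolding A U_def quat_mult quat_eq_iff
      using e1 e2 \<open>N > 0\<close> by (simp add: field_simps)
    moreover have "quat z 0 \<in> carrier SU2"
      using n by (simp add: quat_in_SU2 z_def cmod_power2 \<sigma>2)
    ultimately have "A = U \<otimes>\<^bsub>SU2\<^esub> quat z 0 \<otimes>\<^bsub>SU2\<^esub> inv\<^bsub>SU2\<^esub> U"
      using assms UG SU2.inv_solve_right[of A "U ** quat z 0" U] SU2.m_closed[OF UG, of "quat z 0"] by simp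
    moreover have "Complex (Re (A $ 1 $ 1)) (sqrt (1 - (Re (A $ 1 $ 1))\<^sup>2)) = z"
      by (simp add: A z_def \<sigma>_def)
    ultimately show thesis using that[OF UG] by metis
  qed
qed

lemma SU2_conjugate:
  assumes "A \<in> carrier SU2" "B \<in> carrier SU2" "Re (A $ 1 $ 1) = Re (B $ 1 $ 1)"
  obtains g where "g \<in> carrier SU2" "B = g \<otimes>\<^bsub>SU2\<^esub> A \<otimes>\<^bsub>SU2\<^esub> inv\<^bsub>SU2\<^esub> g"
proof -
  define D where "D = quat (Complex (Re (A $ 1 $ 1)) (sqrt (1 - (Re (A $ 1 $ 1))\<^sup>2))) 0"
  obtain U where U: "U \<in> carrier SU2" "A = U \<otimes>\<^bsub>SU2\<^esub> D \<otimes>\<^bsub>SU2\<^esub> inv\<^bsub>SU2\<^esub> U"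
    unfolding D_def using assms SU2_diagonalize by blast
  obtain V where V: "V \<in> carrier SU2" "B = V \<otimes>\<^bsub>SU2\<^esub> D \<otimes>\<^bsub>SU2\<^esub> inv\<^bsub>SU2\<^esub> V"
    unfolding D_def assms(3) using assms SU2_diagonalize by blast
  obtain p q where "A = quat p q" "(cmod p)\<^sup>2 + (cmod q)\<^sup>2 = 1" using assms SU2_quatE by blast
  then have "(Re p)\<^sup>2 \<le> 1" by (smt (verit) cmod_power2 zero_le_power2)
  then have D: "D \<in> carrier SU2"
    using \<open>A = quat p q\<close> by (simp add: D_def quat_in_SU2 cmod_power2)
  have "B = (V \<otimes>\<^bsub>SU2\<^esub> inv\<^bsub>SU2\<^esub> U) \<otimes>\<^bsub>SU2\<^esub> A \<otimes>\<^bsub>SU2\<^esub> inv\<^bsub>SU2\<^esub> (V \<otimes>\<^bsub>SU2\<^esub> inv\<^bsub>SU2\<^esub> U)"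
    unfolding V(2) U(2)
    using U(1) V(1) D by (simp add: SU2.inv_mult_group SU2.m_assoc del: SU2_simps)
  moreover have "V \<otimes>\<^bsub>SU2\<^esub> inv\<^bsub>SU2\<^esub> U \<in> carrier SU2" using U V by blast
  ultimately show thesis using that by blast
qed

lemma continuous_on_matrix:
  fixes f :: "'a::topological_space \<Rightarrow> 'b::topological_space ^ 'n ^ 'm"
  assumes "\<And>i j. continuous_on S (\<lambda>x. f x $ i $ j)"
  shows "continuous_on S f"
proof -
  have "continuous_on S (\<lambda>x. \<chi> i. \<chi> j. f x $ i $ j)"
    by (intro continuous_on_vec_lambda assms)
  then show ?thesis by simp
qed

text \<open>It is the image of the unit sphere of \<open>\<complex>\<^sup>2 = \<real>\<^sup>4\<close>.\<close>

lemma connected_SU2: "connected (carrier SU2)"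
proof -
  have "carrier SU2 = (\<lambda>x. quat (fst x) (snd x)) ` sphere (0 :: complex \<times> complex) 1"
  proof (intro equalityI subsetI)
    fix A assume "A \<in> carrier SU2"
    then obtain p q where "A = quat p q" "(cmod p)\<^sup>2 + (cmod q)\<^sup>2 = 1" by (rule SU2_quatE)
    then show "A \<in> (\<lambda>x. quat (fst x) (snd x)) ` sphere (0 :: complex \<times> complex) 1"
      by (intro image_eqI[of _ _ "(p, q)"]) (simp_all add: norm_Pair)
  next
    fix A assume "A \<in> (\<lambda>x. quat (fst x) (snd x)) ` sphere (0 :: complex \<times> complex) 1"
    then show "A \<in> carrier SU2" by (auto simp: norm_Pair quat_in_SU2)
  qed
  moreover have "continuous_on S (\<lambda>x. quat (fst x) (snd x) $ i $ j)" for i j S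
    using exhaust_2[of i] exhaust_2[of j] by (elim disjE; simp; intro continuous_intros)
  moreover have "connected (sphere (0 :: complex \<times> complex) 1)"
    by (rule connected_sphere) simp
  ultimately show ?thesis
    by (simp add: connected_continuous_image continuous_on_matrix)
qed

lemma continuous_on_word_map:
  "continuous_on (carrier SU2 \<times> carrier SU2) (word_map SU2 w)"
proof (induction w)
  case Nil
  then show ?case by (simp add: word_map_def case_prod_unfold)
next
  case (Cons l w)
  let ?S = "carrier SU2 \<times> carrier SU2"
  define f where "f v = (case l of (Gen_a, b) \<Rightarrow> if b then fst v else conj_transpose (fst v)
    | (Gen_b, b) \<Rightarrow> if b then snd v else conj_transpose (snd v))" for v :: "(complex^2^2) \<times> (complex^2^2)"
  have eq: "word_map SU2 (l # w) v = f v ** word_map SU2 w v" if "v \<in> ?S" for v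
    using that by (cases "(SU2, fst v, snd v, l)" rule: letter_eval.cases)
      (auto simp: word_map_def f_def inv_SU2)
  have "continuous_on ?S (\<lambda>v. f v $ i $ j)" for i j
    by (cases l; cases "fst l"; cases "snd l") (auto simp: f_def conj_transpose_def intro!: continuous_intros)
  then have f: "continuous_on ?S f" by (rule continuous_on_matrix)
  have "continuous_on ?S (\<lambda>v. (f v ** word_map SU2 w v) $ i $ j)" for i j
    unfolding matrix_matrix_mult_def by simp (intro continuous_intros f Cons)
  then have "continuous_on ?S (\<lambda>v. f v ** word_map SU2 w v)" by (rule continuous_on_matrix)
  then show ?case using eq by (simp cong: continuous_on_cong)
qed

text \<open>Half the trace of the values runs through a connected set of reals that contains \<open>-1\<close> and the
  value \<open>1\<close> at the identity pair, hence through all of \<open>[-1, 1]\<close>; conjugacy then reaches every element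
  with a given trace.\<close>

lemma word_map_surjective_if_minus_one:
  assumes "x \<in> carrier SU2" "y \<in> carrier SU2" "word_map SU2 w (x, y) = quat (-1) 0"
  shows "word_map_surjective SU2 w"
  unfolding word_map_surjective_def
proof (intro equalityI subsetI)
  fix A assume "A \<in> word_map SU2 w ` (carrier SU2 \<times> carrier SU2)"
  then show "A \<in> carrier SU2" using word_map_closed[OF group_SU2] by auto
next
  let ?S = "carrier SU2 \<times> carrier SU2"
  let ?f = "\<lambda>v. Re (word_map SU2 w v $ 1 $ 1)"
  fix A assume A: "A \<in> carrier SU2"
  have "connected (?f ` ?S)"
    by (intro connected_continuous_image continuous_intros continuous_on_word_map
        connected_Times connected_SU2)
  moreover have "- 1 \<in> ?f ` ?S"
    using assms by (intro image_eqI[where x = "(x, y)"]) auto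
  moreover have "1 \<in> ?f ` ?S"
  proof (rule image_eqI)
    have "word_map SU2 w (\<one>\<^bsub>SU2\<^esub>, \<one>\<^bsub>SU2\<^esub>) = \<one>\<^bsub>SU2\<^esub>"
    proof (induction w)
      case (Cons l w)
      have "letter_eval SU2 \<one>\<^bsub>SU2\<^esub> \<one>\<^bsub>SU2\<^esub> l = \<one>\<^bsub>SU2\<^esub>"
        by (cases "(SU2, \<one>\<^bsub>SU2\<^esub>, \<one>\<^bsub>SU2\<^esub>, l)" rule: letter_eval.cases)
          (auto simp del: SU2_simps)
      with Cons show ?case by (simp add: word_map_def)
    qed (simp add: word_map_def)
    then show "1 = ?f (\<one>\<^bsub>SU2\<^esub>, \<one>\<^bsub>SU2\<^esub>)" by (simp add: quat_one)
  qed (use SU2.one_closed in blast)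
  moreover have "- 1 \<le> Re (A $ 1 $ 1)" "Re (A $ 1 $ 1) \<le> 1"
  proof -
    obtain p q where "A = quat p q" "(cmod p)\<^sup>2 + (cmod q)\<^sup>2 = 1" using A SU2_quatE by blast
    then have "\<bar>Re (A $ 1 $ 1)\<bar> \<le> 1"
      by (smt (verit) abs_Re_le_cmod power2_le_imp_le one_power2 zero_le_power2 quat_nth(1))
    then show "- 1 \<le> Re (A $ 1 $ 1)" "Re (A $ 1 $ 1) \<le> 1" by auto
  qed
  ultimately have "Re (A $ 1 $ 1) \<in> ?f ` ?S" by (rule connectedD_interval)
  then obtain u v where uv: "u \<in> carrier SU2" "v \<in> carrier SU2"
    "Re (word_map SU2 w (u, v) $ 1 $ 1) = Re (A $ 1 $ 1)" by auto
  then obtain g where g: "g \<in> carrier SU2"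
    "A = g \<otimes>\<^bsub>SU2\<^esub> word_map SU2 w (u, v) \<otimes>\<^bsub>SU2\<^esub> inv\<^bsub>SU2\<^esub> g"
    using SU2_conjugate[OF _ A] word_map_closed[OF group_SU2] by metis
  let ?v = "(g \<otimes>\<^bsub>SU2\<^esub> u \<otimes>\<^bsub>SU2\<^esub> inv\<^bsub>SU2\<^esub> g, g \<otimes>\<^bsub>SU2\<^esub> v \<otimes>\<^bsub>SU2\<^esub> inv\<^bsub>SU2\<^esub> g)"
  show "A \<in> word_map SU2 w ` ?S"
  proof (rule image_eqI)
    show "A = word_map SU2 w ?v" using word_map_conj[OF group_SU2 uv(1,2) g(1)] g(2) by simp
    show "?v \<in> ?S" using g uv by (simp del: SU2_simps)
  qed
qed

section \<open>Pairs for which a commutator anticommutes with its conjugate\<close>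

text \<open>The difference of the two sides is \<open>1/2\<close> at \<open>\<pi>/4\<close>, so it vanishes somewhere in
  \<open>[\<pi>/4, \<pi>/2]\<close> as soon as it is nonpositive at one point there: at \<open>\<pi>/2\<close> for odd \<open>n\<close>, and at
  \<open>\<pi>/2 - \<pi>/(2n)\<close>, where \<open>cos 2n\<theta> = -1\<close>, for even \<open>n \<ge> 4\<close>. For \<open>n = 2\<close> the difference never becomes
  negative on the interval, but it touches zero at \<open>\<pi>/3\<close>.\<close>

lemma exists_angle:
  fixes n :: nat
  assumes "n \<ge> 1"
  obtains \<theta> :: real where "1 \<le> 2 * (sin \<theta>)\<^sup>2" "(cos \<theta>)\<^sup>2 = cos (2 * \<theta>) * cos (2 * (n * \<theta>))"
proof -
  define F where "F t = (cos t)\<^sup>2 - cos (2 * t) * cos (2 * (n * t))" for t :: real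
  have F4: "F (pi / 4) = 1 / 2" by (simp add: F_def cos_45 power_divide)
  note angleI = that
  have IVT: thesis if t: "pi / 4 \<le> t" "t \<le> pi / 2" "F t \<le> 0" for t
  proof -
    have "continuous_on {pi / 4..t} F" unfolding F_def by (intro continuous_intros)
    then obtain x where x: "pi / 4 \<le> x" "x \<le> t" "F x = 0"
      using IVT2'[of F t 0 "pi / 4"] t F4 by auto
    have "cos (2 * x) \<le> 0"
      using x t cos_monotone_0_pi_le[of "pi / 2" "2 * x"] by simp
    then show thesis
      using angleI[of x] x cos_double_sin[of x] by (simp add: F_def)
  qed
  consider "odd n" | "n = 2" | "even n" "n \<ge> 4" using assms by fastforce
  then show thesis
  proof cases
    case 1
    then obtain k where "n = 2 * k + 1" by (elim oddE)
    then have "cos (n * pi) = - 1" using cos_npi[of n] by (simp add: mult.commute)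
    then show thesis using IVT[of "pi / 2"] by (simp add: F_def)
  next
    case 2
    have "cos (2 * (2 * (pi / 3))) = - (1 / 2)"
      using cos_double_cos[of "2 * (pi / 3)"] cos_120 by (simp add: power2_eq_square)
    then show thesis
      using that[of "pi / 3"] 2 cos_120 by (simp add: cos_60 sin_60 power_divide)
  next
    case 3
    define h where "h = pi / (2 * n)"
    have h: "0 < h" "h \<le> pi / 8" using 3 by (auto simp: h_def field_simps)
    have "cos (2 * (n * (pi / 2 - h))) = cos (n * pi - pi)"
      using 3 by (simp add: h_def algebra_simps)
    also have "\<dots> = - 1" using \<open>even n\<close> by (simp add: cos_diff mult.commute)
    finally have c: "cos (2 * (n * (pi / 2 - h))) = - 1" .
    have "sin h \<ge> 0" using h pi_gt_zero by (intro sin_ge_zero) auto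
    moreover have "sin h \<le> 1 / 2"
      using sin_x_le_x[of h] h pi_less_4 by simp
    ultimately have "(sin h)\<^sup>2 \<le> (1 / 2)\<^sup>2" by (intro power_mono)
    then have "F (pi / 2 - h) \<le> 0"
      unfolding F_def c cos_double_cos[of "pi / 2 - h"] by (simp add: cos_diff power_divide)
    then show thesis using IVT[of "pi / 2 - h"] h pi_gt_zero by simp
  qed
qed

lemma quat_diag_pow:
  "quat z 0 [^]\<^bsub>SU2\<^esub> (k::nat) = quat (z ^ k) 0"
  by (induction k) (auto simp: quat_mult quat_one mult.commute)

lemma commutator_quat_diag:
  fixes q :: real and p z :: complex
  assumes "cmod z = 1" "(cmod p)\<^sup>2 + q\<^sup>2 = 1"
  shows "commutator SU2 (quat z 0) (quat p q) = quat (1 - q\<^sup>2 * (1 - z\<^sup>2)) (p * q * (z\<^sup>2 - 1))"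
proof -
  have z: "z * cnj z = 1" using assms complex_norm_square[of z] by simp
  have "(cmod p)\<^sup>2 = 1 - q\<^sup>2" using assms by simp
  then have "p * cnj p = of_real (1 - q\<^sup>2)" by (simp only: complex_norm_square[symmetric])
  then have p: "p * cnj p = 1 - (of_real q)\<^sup>2" by simp
  have "z * p * cnj z * cnj p + z * q * z * q = 1 - (of_real q)\<^sup>2 * (1 - z\<^sup>2)" using p z by algebra
  moreover have "z * q * z * p - z * p * cnj z * q = p * q * (z\<^sup>2 - 1)" using z by algebra
  ultimately show ?thesis using assms
    by (simp add: commutator_def quat_mult quat_eq_iff algebra_simps)
qed

text \<open>The first hypothesis makes \<open>C\<close> purely imaginary, say \<open>C = ia + B j\<close>. Conjugation by \<open>X\<^sup>n\<close>
  multiplies \<open>B\<close> by \<open>w = exp(2in\<theta>)\<close>, so \<open>C\<close> and its conjugate have inner product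
  \<open>a\<^sup>2 + \<bar>B\<bar>\<^sup>2 Re w\<close>. Multiplied by \<open>(sin \<theta>)\<^sup>2\<close> this is \<open>(cos \<theta>)\<^sup>2 - cos 2\<theta> cos 2n\<theta>\<close>, which the
  last hypothesis makes zero; orthogonal imaginary quaternions anticommute.\<close>

lemma commutator_diag_conj_eq_minus_one:
  fixes n :: nat and q \<theta> :: real
  assumes q: "2 * q\<^sup>2 * (sin \<theta>)\<^sup>2 = 1" and p: "(cmod p)\<^sup>2 + q\<^sup>2 = 1"
    and \<theta>: "(cos \<theta>)\<^sup>2 = cos (2 * \<theta>) * cos (2 * (n * \<theta>))"
  defines "X \<equiv> quat (cis \<theta>) 0"
  defines "C \<equiv> commutator SU2 X (quat p q)"
  shows "commutator SU2 C (X [^]\<^bsub>SU2\<^esub> n \<otimes>\<^bsub>SU2\<^esub> C \<otimes>\<^bsub>SU2\<^esub> inv\<^bsub>SU2\<^esub> (X [^]\<^bsub>SU2\<^esub> n)) = quat (-1) 0"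
proof -
  define a B w where "a = q\<^sup>2 * sin (2 * \<theta>)" and "B = p * q * (cis (2 * \<theta>) - 1)"
    and "w = cis (2 * (n * \<theta>))"
  have z2: "(cis \<theta>)\<^sup>2 = cis (2 * \<theta>)" by (simp add: Complex.DeMoivre)
  have "q\<^sup>2 * (1 - cos (2 * \<theta>)) = 1"
    using q unfolding cos_double_sin by (simp add: algebra_simps)
  then have "1 - q\<^sup>2 * (1 - cis (2 * \<theta>)) = \<i> * a"
    by (simp add: complex_eq_iff a_def algebra_simps)
  then have C: "C = quat (\<i> * a) B"
    unfolding C_def X_def B_def using p by (simp add: commutator_quat_diag z2)
  have XG: "X \<in> carrier SU2" "quat p q \<in> carrier SU2" using p by (simp_all add: X_def quat_in_SU2)
  then have CG: "C \<in> carrier SU2" by (simp add: C_def del: SU2_simps)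
  have D: "X [^]\<^bsub>SU2\<^esub> n \<otimes>\<^bsub>SU2\<^esub> C \<otimes>\<^bsub>SU2\<^esub> inv\<^bsub>SU2\<^esub> (X [^]\<^bsub>SU2\<^esub> n) = quat (\<i> * a) (w * B)"
    (is "?D = _")
  proof -
    have w: "cis (n * \<theta>) * cis (n * \<theta>) = w" by (simp add: cis_mult w_def mult_ac)
    have u: "cis (n * \<theta>) * cnj (cis (n * \<theta>)) = 1" by (simp add: cis_cnj cis_mult)
    have "cis (n * \<theta>) * (\<i> * a) * cnj (cis (n * \<theta>)) = \<i> * a" using u by algebra
    moreover have "cis (n * \<theta>) * B * cis (n * \<theta>) = w * B" by (simp add: w[symmetric] mult_ac)
    ultimately show ?thesis
      by (simp add: C X_def quat_diag_pow Complex.DeMoivre quat_mult quat_eq_iff)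
  qed
  have DG: "?D \<in> carrier SU2" using XG CG by (simp del: SU2_simps)
  have "(sin \<theta>)\<^sup>2 * (a\<^sup>2 + (cmod B)\<^sup>2 * Re w) = 0"
  proof -
    have "(cmod (cis (2 * \<theta>) - 1))\<^sup>2 = 2 - 2 * cos (2 * \<theta>)"
      using sin_cos_squared_add[of "2 * \<theta>"]
      unfolding cmod_power2 by (simp add: power2_eq_square algebra_simps)
    then have "(cmod (cis (2 * \<theta>) - 1))\<^sup>2 = 4 * (sin \<theta>)\<^sup>2"
      unfolding cos_double_sin by simp
    moreover have "(cmod B)\<^sup>2 = (cmod p)\<^sup>2 * q\<^sup>2 * (cmod (cis (2 * \<theta>) - 1))\<^sup>2"
      by (simp add: B_def norm_mult power_mult_distrib)
    moreover have "(cmod p)\<^sup>2 = 1 - q\<^sup>2" using p by simp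
    ultimately have "(cmod B)\<^sup>2 = (1 - q\<^sup>2) * q\<^sup>2 * (4 * (sin \<theta>)\<^sup>2)" by simp
    then have "(sin \<theta>)\<^sup>2 * (cmod B)\<^sup>2 = - cos (2 * \<theta>)"
      using q unfolding cos_double_sin by algebra
    moreover have "(sin \<theta>)\<^sup>2 * a\<^sup>2 = (cos \<theta>)\<^sup>2"
      using q unfolding a_def sin_double by algebra
    moreover have "Re w = cos (2 * (n * \<theta>))" by (simp add: w_def)
    ultimately show ?thesis using \<theta> by algebra
  qed
  then have r: "a\<^sup>2 + (cmod B)\<^sup>2 * Re w = 0" using q by auto
  have "B * cnj B * (w + cnj w) = of_real (2 * (cmod B)\<^sup>2 * Re w)"
    by (simp add: complex_norm_square[symmetric] complex_add_cnj)
  also have "2 * (cmod B)\<^sup>2 * Re w = - 2 * a\<^sup>2" using r by algebra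
  finally have "B * cnj B * (w + cnj w) = - 2 * (of_real a)\<^sup>2" by simp
  then have "C ** ?D = quat (-1) 0 ** (?D ** C)"
    unfolding D unfolding C quat_mult quat_eq_iff
    by (simp add: algebra_simps power2_eq_square)
  then show ?thesis
    using SU2.commutator_eq_iff[OF CG DG, of "quat (-1) 0"] by (simp add: quat_in_SU2)
qed

text \<open>A unit quaternion squares to \<open>-1\<close> when its trace is \<open>0\<close>, so the diagonal entry of \<open>Y\<close> is chosen
  on the imaginary axis.\<close>

lemma exists_pair_square_minus_one:
  fixes n :: int
  assumes "n \<ge> 1"
  obtains X Y C where "X \<in> carrier SU2" "Y \<in> carrier SU2" "Y \<otimes>\<^bsub>SU2\<^esub> Y = quat (-1) 0"
    "C = commutator SU2 X Y"
    "commutator SU2 C (X [^]\<^bsub>SU2\<^esub> n \<otimes>\<^bsub>SU2\<^esub> C \<otimes>\<^bsub>SU2\<^esub> inv\<^bsub>SU2\<^esub> (X [^]\<^bsub>SU2\<^esub> n)) = quat (-1) 0"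
proof -
  have "nat n \<ge> 1" using assms by simp
  then obtain \<theta> :: real where \<theta>: "1 \<le> 2 * (sin \<theta>)\<^sup>2" "(cos \<theta>)\<^sup>2 = cos (2 * \<theta>) * cos (2 * (nat n * \<theta>))"
    using exists_angle by blast
  define q where "q = sqrt (1 / (2 * (sin \<theta>)\<^sup>2))"
  define p where "p = \<i> * sqrt (1 - q\<^sup>2)"
  have q2: "q\<^sup>2 = 1 / (2 * (sin \<theta>)\<^sup>2)" by (simp add: q_def)
  then have q: "2 * q\<^sup>2 * (sin \<theta>)\<^sup>2 = 1" using \<theta>(1) by auto
  have "q\<^sup>2 \<le> 1" using q2 \<theta>(1) by (simp add: divide_le_eq_1)
  then have p: "(cmod p)\<^sup>2 + q\<^sup>2 = 1" by (simp add: p_def norm_mult)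
  have "(of_real (sqrt (1 - q\<^sup>2)))\<^sup>2 = complex_of_real (1 - q\<^sup>2)"
    using \<open>q\<^sup>2 \<le> 1\<close> by (metis diff_ge_0_iff_ge of_real_power real_sqrt_pow2)
  then have square: "quat p q ** quat p q = quat (-1) 0"
    by (simp add: quat_mult quat_eq_iff p_def algebra_simps power2_eq_square)
  have pow: "x [^]\<^bsub>SU2\<^esub> n = x [^]\<^bsub>SU2\<^esub> nat n" for x
    using assms by simp
  show thesis
  proof (rule that[OF _ _ _ refl])
    show "quat (cis \<theta>) 0 \<in> carrier SU2" "quat p q \<in> carrier SU2"
      using p by (simp_all add: quat_in_SU2)
    show "quat p q \<otimes>\<^bsub>SU2\<^esub> quat p q = quat (-1) 0" using square by simp
  qed (unfold pow, rule commutator_diag_conj_eq_minus_one[OF q p \<theta>(2)])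
qed

text \<open>De Moivre's formula: the imaginary part keeps its direction, while its length \<open>\<bar>sin \<alpha>\<bar>\<close> is scaled
  by \<open>sin k\<alpha> / sin \<alpha>\<close>.\<close>

lemma quat_power_DeMoivre:
  fixes \<alpha> y :: real and q :: complex
  assumes s0: "sin \<alpha> \<noteq> 0" and n: "y\<^sup>2 + (cmod q)\<^sup>2 = (sin \<alpha>)\<^sup>2"
  shows "quat (Complex (cos \<alpha>) y) q [^]\<^bsub>SU2\<^esub> (k::nat) =
    quat (Complex (cos (k * \<alpha>)) (y * (sin (k * \<alpha>) / sin \<alpha>))) (q * (sin (k * \<alpha>) / sin \<alpha>))"
proof (induction k)
  case (Suc k)
  define S where "S = sin (k * \<alpha>) / sin \<alpha>"
  have "sin (k * \<alpha>) = S * sin \<alpha>" using s0 by (simp add: S_def)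
  then have s1: "sin (Suc k * \<alpha>) / sin \<alpha> = cos (k * \<alpha>) + S * cos \<alpha>"
    and c1: "cos (Suc k * \<alpha>) = cos (k * \<alpha>) * cos \<alpha> - S * (sin \<alpha>)\<^sup>2"
    using s0 by (simp_all add: sin_add cos_add field_simps power2_eq_square)
  have "(cmod q)\<^sup>2 = (sin \<alpha>)\<^sup>2 - y\<^sup>2" using n by simp
  then have "q * cnj q = of_real ((sin \<alpha>)\<^sup>2 - y\<^sup>2)" by (simp only: complex_norm_square[symmetric])
  moreover have "q * S * cnj q = S * (q * cnj q)" by simp
  ultimately have qq: "q * S * cnj q = of_real (S * ((sin \<alpha>)\<^sup>2 - y\<^sup>2))" by (simp only: of_real_mult)
  have "Complex (cos (k * \<alpha>)) (y * S) * Complex (cos \<alpha>) y - q * S * cnj q =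
      Complex (cos (k * \<alpha>) * cos \<alpha> - S * (sin \<alpha>)\<^sup>2) (y * (cos (k * \<alpha>) + S * cos \<alpha>))"
    unfolding qq by (simp add: complex_eq_iff algebra_simps power2_eq_square)
  moreover have "Complex (cos (k * \<alpha>)) (y * S) * q + q * S * cnj (Complex (cos \<alpha>) y) =
      q * of_real (cos (k * \<alpha>) + S * cos \<alpha>)"
    by (simp add: complex_eq_iff algebra_simps)
  ultimately show ?case
    unfolding s1 c1 nat_pow_Suc Suc[folded S_def] SU2_simps quat_mult by simp
qed (simp add: quat_one quat_eq_iff complex_eq_iff)

text \<open>Since \<open>\<theta> = \<pi>/3\<close> forces \<open>q\<^sup>2 = 2/3\<close>, the angle \<open>\<alpha>\<close> of \<open>Y\<close> can be any with
  \<open>(cos \<alpha>)\<^sup>2 \<le> 1/3\<close>. A power \<open>n + 1\<close> that is \<open>\<plusminus>1\<close> needs a multiple of \<open>\<pi>/(n+1)\<close>, and for \<open>n \<ge> 2\<close> the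
  first one in \<open>[\<pi>/2, \<pi>]\<close> exceeds \<open>\<pi>/2\<close> by at most \<open>\<pi>/6\<close>, so that \<open>(cos \<alpha>)\<^sup>2 \<le> 1/4\<close>.\<close>

lemma exists_pair_power_central:
  fixes n :: nat
  assumes "n \<ge> 2"
  obtains X Y C where "X \<in> carrier SU2" "Y \<in> carrier SU2"
    "Y [^]\<^bsub>SU2\<^esub> Suc n \<in> {\<one>\<^bsub>SU2\<^esub>, quat (-1) 0}"
    "C = commutator SU2 X Y"
    "commutator SU2 C (X \<otimes>\<^bsub>SU2\<^esub> C \<otimes>\<^bsub>SU2\<^esub> inv\<^bsub>SU2\<^esub> X) = quat (-1) 0"
proof -
  define m where "m = n div 2 + 1"
  define \<alpha> where "\<alpha> = m * pi / Suc n"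
  define \<beta> where "\<beta> = \<alpha> - pi / 2"
  define q where "q = sqrt (2 / 3)"
  define y where "y = sqrt (1 / 3 - (cos \<alpha>)\<^sup>2)"
  define p where "p = Complex (cos \<alpha>) y"
  have m: "2 * real m \<ge> n + 1" "2 * real m \<le> n + 2" by (auto simp: m_def)
  have \<beta>: "\<beta> = pi * (2 * real m - real (Suc n)) / (2 * Suc n)"
    by (simp add: \<beta>_def \<alpha>_def field_simps)
  have "\<beta> \<ge> 0" unfolding \<beta> using m by (intro divide_nonneg_nonneg mult_nonneg_nonneg) auto
  have "\<beta> \<le> pi * 1 / (2 * 3)"
    unfolding \<beta> using m assms by (intro frac_le mult_left_mono) auto
  then have b6: "\<beta> \<le> pi / 6" by simp
  have "sin \<beta> \<le> 1 / 2" using sin_monotone_2pi_le[of \<beta> "pi / 6"] b6 \<open>\<beta> \<ge> 0\<close> pi_gt_zero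
    by (simp add: sin_30)
  moreover have "sin \<beta> \<ge> 0" using b6 \<open>\<beta> \<ge> 0\<close> pi_gt_zero by (intro sin_ge_zero) auto
  ultimately have "(sin \<beta>)\<^sup>2 \<le> (1 / 2)\<^sup>2" by (intro power_mono)
  then have c: "(cos \<alpha>)\<^sup>2 \<le> 1 / 4" by (simp add: \<beta>_def sin_diff power_divide)
  then have y2: "y\<^sup>2 = 1 / 3 - (cos \<alpha>)\<^sup>2" by (simp add: y_def)
  have s: "(sin \<alpha>)\<^sup>2 = 1 - (cos \<alpha>)\<^sup>2" by (simp add: sin_squared_eq)
  then have s0: "sin \<alpha> \<noteq> 0" using c by auto
  have q: "2 * q\<^sup>2 * (sin (pi / 3))\<^sup>2 = 1" by (simp add: q_def sin_60 power_divide)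
  have p: "(cmod p)\<^sup>2 + q\<^sup>2 = 1" by (simp add: p_def cmod_power2 y2 q_def)
  have "Suc n * \<alpha> = m * pi" by (simp add: \<alpha>_def)
  then have "quat p q [^]\<^bsub>SU2\<^esub> Suc n = quat (of_real ((- 1) ^ m)) 0"
    unfolding p_def
    by (subst quat_power_DeMoivre) (auto simp: s0 y2 s q_def quat_eq_iff complex_eq_iff simp del: of_nat_Suc nat_pow_Suc)
  then have pow: "quat p q [^]\<^bsub>SU2\<^esub> Suc n \<in> {\<one>\<^bsub>SU2\<^esub>, quat (-1) 0}"
    by (cases "even m") (simp_all add: quat_one del: nat_pow_Suc)
  have "(cos (pi / 3))\<^sup>2 = cos (2 * (pi / 3)) * cos (2 * (1 * (pi / 3)))"
    using cos_120 by (simp add: cos_60 power_divide)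
  from commutator_diag_conj_eq_minus_one[of q "pi / 3" p 1, OF q p] this
  show thesis
    using that[of "quat (cis (pi / 3)) 0" "quat p q"] pow p
    by (simp add: quat_in_SU2)
qed

section \<open>The seven families of words\<close>

interpretation F2: group F2 by (rule group_F2)

declare a_F2_in_carrier [simp] b_F2_in_carrier [simp]

text \<open>The conjugating word may take a value \<open>z g\<close> with a sign \<open>z\<close>, because signs cancel in a
  conjugation.\<close>

lemma commutator_conj_word_surjective:
  assumes "x \<in> carrier SU2" "y \<in> carrier SU2" "u \<in> carrier F2" "v \<in> carrier F2"
    and inv: "word_map SU2 v (x, y) = inv\<^bsub>SU2\<^esub> (word_map SU2 u (x, y))"
    and g: "word_map SU2 u (x, y) = z \<otimes>\<^bsub>SU2\<^esub> g" "z \<in> {\<one>\<^bsub>SU2\<^esub>, quat (-1) 0}" "g \<in> carrier SU2"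
    and c: "commutator SU2 x y = c" "commutator SU2 c (g \<otimes>\<^bsub>SU2\<^esub> c \<otimes>\<^bsub>SU2\<^esub> inv\<^bsub>SU2\<^esub> g) = quat (-1) 0"
  shows "word_map_surjective SU2
    (commutator F2 (commutator F2 a_F2 b_F2) (u \<otimes>\<^bsub>F2\<^esub> commutator F2 a_F2 b_F2 \<otimes>\<^bsub>F2\<^esub> v))"
proof (rule word_map_surjective_if_minus_one)
  show "x \<in> carrier SU2" "y \<in> carrier SU2" by fact+
  have cG: "c \<in> carrier SU2" using assms by (auto simp del: SU2_simps)
  have "z \<otimes>\<^bsub>SU2\<^esub> g \<otimes>\<^bsub>SU2\<^esub> c \<otimes>\<^bsub>SU2\<^esub> inv\<^bsub>SU2\<^esub> (z \<otimes>\<^bsub>SU2\<^esub> g) = g \<otimes>\<^bsub>SU2\<^esub> c \<otimes>\<^bsub>SU2\<^esub> inv\<^bsub>SU2\<^esub> g"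
    using SU2.central_one_involution[OF central_involution_minus_one g(2)] cG g(3)
    by (rule SU2.conj_mult_central)
  then show "word_map SU2 (commutator F2 (commutator F2 a_F2 b_F2)
      (u \<otimes>\<^bsub>F2\<^esub> commutator F2 a_F2 b_F2 \<otimes>\<^bsub>F2\<^esub> v)) (x, y) = quat (-1) 0"
    using assms group_SU2
    by (simp add: word_map_mult_F2 word_map_commutator_F2 word_map_a_F2 word_map_b_F2 del: SU2_simps)
qed

theorem theorem1p2:
  shows
   "(\<forall>n::int. n \<ge> 1 \<longrightarrow>
        word_map_surjective SU2
          (commutator F2 (commutator F2 a_F2 b_F2)
             (a_F2 [^]\<^bsub>F2\<^esub> n \<otimes>\<^bsub>F2\<^esub> commutator F2 a_F2 b_F2 \<otimes>\<^bsub>F2\<^esub> a_F2 [^]\<^bsub>F2\<^esub> (- n)))) \<and>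
    (\<forall>n::int. n \<ge> 1 \<longrightarrow>
        word_map_surjective SU2
          (commutator F2 (commutator F2 a_F2 b_F2)
             (b_F2 [^]\<^bsub>F2\<^esub> n \<otimes>\<^bsub>F2\<^esub> commutator F2 a_F2 b_F2 \<otimes>\<^bsub>F2\<^esub> b_F2 [^]\<^bsub>F2\<^esub> (- n)))) \<and>
    (\<forall>n::int. n \<ge> 1 \<longrightarrow>
        word_map_surjective SU2
          (commutator F2 (commutator F2 a_F2 b_F2)
             ((a_F2 \<otimes>\<^bsub>F2\<^esub> b_F2) [^]\<^bsub>F2\<^esub> n \<otimes>\<^bsub>F2\<^esub> commutator F2 a_F2 b_F2 \<otimes>\<^bsub>F2\<^esub> (a_F2 \<otimes>\<^bsub>F2\<^esub> b_F2) [^]\<^bsub>F2\<^esub> (- n)))) \<and>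
    (\<forall>n::int. n \<ge> 2 \<longrightarrow>
        word_map_surjective SU2
          (commutator F2 (commutator F2 a_F2 b_F2)
             (a_F2 [^]\<^bsub>F2\<^esub> n \<otimes>\<^bsub>F2\<^esub> b_F2 \<otimes>\<^bsub>F2\<^esub> commutator F2 a_F2 b_F2 \<otimes>\<^bsub>F2\<^esub> inv\<^bsub>F2\<^esub> b_F2 \<otimes>\<^bsub>F2\<^esub> a_F2 [^]\<^bsub>F2\<^esub> (- n)))) \<and>
    (\<forall>n::int. n \<ge> 1 \<longrightarrow>
        word_map_surjective SU2
          (commutator F2 (commutator F2 a_F2 b_F2)
             (a_F2 [^]\<^bsub>F2\<^esub> n \<otimes>\<^bsub>F2\<^esub> b_F2 [^]\<^bsub>F2\<^esub> (2::int) \<otimes>\<^bsub>F2\<^esub> commutator F2 a_F2 b_F2 \<otimes>\<^bsub>F2\<^esub> b_F2 [^]\<^bsub>F2\<^esub> (- 2::int) \<otimes>\<^bsub>F2\<^esub> a_F2 [^]\<^bsub>F2\<^esub> (- n)))) \<and>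
    (\<forall>(n::int) (m::int). n \<ge> 2 \<and> m \<ge> 2 \<and> n mod 6 \<in> {1, 2, 4, 5} \<and> m mod 4 \<in> {0, 2} \<longrightarrow>
        word_map_surjective SU2
          (commutator F2 (commutator F2 a_F2 b_F2)
             (a_F2 [^]\<^bsub>F2\<^esub> n \<otimes>\<^bsub>F2\<^esub> b_F2 [^]\<^bsub>F2\<^esub> m \<otimes>\<^bsub>F2\<^esub> commutator F2 a_F2 b_F2 \<otimes>\<^bsub>F2\<^esub> b_F2 [^]\<^bsub>F2\<^esub> (- m) \<otimes>\<^bsub>F2\<^esub> a_F2 [^]\<^bsub>F2\<^esub> (- n)))) \<and>
    (\<forall>n::int. n \<ge> 2 \<longrightarrow>
        word_map_surjective SU2
          (commutator F2 (commutator F2 a_F2 b_F2)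
             (commutator F2 a_F2 ((a_F2 \<otimes>\<^bsub>F2\<^esub> b_F2) [^]\<^bsub>F2\<^esub> n))))"
proof (intro conjI allI impI)
  note [simp] = word_map_mult_F2[OF group_SU2] word_map_inv_F2[OF group_SU2]
    word_map_int_pow_F2[OF group_SU2] word_map_commutator_F2[OF group_SU2]
    word_map_a_F2[OF group_SU2] word_map_b_F2[OF group_SU2]
    SU2.int_pow_neg SU2.inv_mult_group SU2.m_assoc
  note [simp del] = SU2_simps
  note inv = SU2.commutator_conj_inv_involution[OF central_involution_minus_one]
  note even_pow = SU2.even_int_pow_square_involution[OF central_involution_minus_one]
  fix n :: int
  {
    assume n: "n \<ge> 1"
    obtain X Y C where XY [simp]: "X \<in> carrier SU2" "Y \<in> carrier SU2" and Y: "Y \<otimes>\<^bsub>SU2\<^esub> Y = quat (-1) 0"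
      and C: "C = commutator SU2 X Y"
      and com: "commutator SU2 C (X [^]\<^bsub>SU2\<^esub> n \<otimes>\<^bsub>SU2\<^esub> C \<otimes>\<^bsub>SU2\<^esub> inv\<^bsub>SU2\<^esub> (X [^]\<^bsub>SU2\<^esub> n)) = quat (-1) 0"
      using exists_pair_square_minus_one[OF n] by metis
    have CG: "C \<in> carrier SU2" by (simp add: C)
    show "word_map_surjective SU2
          (commutator F2 (commutator F2 a_F2 b_F2)
             (a_F2 [^]\<^bsub>F2\<^esub> n \<otimes>\<^bsub>F2\<^esub> commutator F2 a_F2 b_F2 \<otimes>\<^bsub>F2\<^esub> a_F2 [^]\<^bsub>F2\<^esub> (- n)))"
      by (rule commutator_conj_word_surjective[where x = X and y = Y and z = "\<one>\<^bsub>SU2\<^esub>",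
            OF _ _ _ _ _ _ _ _ C[symmetric] com]) simp_all
    show "word_map_surjective SU2
          (commutator F2 (commutator F2 a_F2 b_F2)
             (b_F2 [^]\<^bsub>F2\<^esub> n \<otimes>\<^bsub>F2\<^esub> commutator F2 a_F2 b_F2 \<otimes>\<^bsub>F2\<^esub> b_F2 [^]\<^bsub>F2\<^esub> (- n)))"
      by (rule commutator_conj_word_surjective[where x = Y and y = X and z = "\<one>\<^bsub>SU2\<^esub>",
            OF _ _ _ _ _ _ _ _ _ inv[OF CG _ com]]) (simp_all add: C SU2.inv_commutator del: SU2.m_assoc)
    show "word_map_surjective SU2
          (commutator F2 (commutator F2 a_F2 b_F2)
             ((a_F2 \<otimes>\<^bsub>F2\<^esub> b_F2) [^]\<^bsub>F2\<^esub> n \<otimes>\<^bsub>F2\<^esub> commutator F2 a_F2 b_F2 \<otimes>\<^bsub>F2\<^esub> (a_F2 \<otimes>\<^bsub>F2\<^esub> b_F2) [^]\<^bsub>F2\<^esub> (- n)))"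
      by (rule commutator_conj_word_surjective[where x = "inv\<^bsub>SU2\<^esub> Y" and y = "Y \<otimes>\<^bsub>SU2\<^esub> X" and z = "\<one>\<^bsub>SU2\<^esub>",
            OF _ _ _ _ _ _ _ _ _ com]) (simp_all add: C SU2.commutator_inv_mult)
    \<comment> \<open>For even \<open>m\<close> the power \<open>Y\<^sup>m\<close> is a sign, and the words reduce to the case without \<open>b\<^sup>m\<close>.\<close>
    have even_case: "word_map_surjective SU2
          (commutator F2 (commutator F2 a_F2 b_F2)
             (a_F2 [^]\<^bsub>F2\<^esub> n \<otimes>\<^bsub>F2\<^esub> b_F2 [^]\<^bsub>F2\<^esub> m \<otimes>\<^bsub>F2\<^esub> commutator F2 a_F2 b_F2 \<otimes>\<^bsub>F2\<^esub> b_F2 [^]\<^bsub>F2\<^esub> (- m) \<otimes>\<^bsub>F2\<^esub> a_F2 [^]\<^bsub>F2\<^esub> (- n)))"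
      if "even m" for m :: int
    proof -
      have z: "Y [^]\<^bsub>SU2\<^esub> m \<in> {\<one>\<^bsub>SU2\<^esub>, quat (-1) 0}"
        using even_pow XY(2) Y that by blast
      have comm: "X [^]\<^bsub>SU2\<^esub> n \<otimes>\<^bsub>SU2\<^esub> Y [^]\<^bsub>SU2\<^esub> m = Y [^]\<^bsub>SU2\<^esub> m \<otimes>\<^bsub>SU2\<^esub> X [^]\<^bsub>SU2\<^esub> n"
        using SU2.central_one_involution[OF central_involution_minus_one z]
        unfolding SU2.central_def by (blast intro: SU2.int_pow_closed XY)
      moreover have "inv\<^bsub>SU2\<^esub> (Y [^]\<^bsub>SU2\<^esub> m) \<otimes>\<^bsub>SU2\<^esub> inv\<^bsub>SU2\<^esub> (X [^]\<^bsub>SU2\<^esub> n) =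
          inv\<^bsub>SU2\<^esub> (X [^]\<^bsub>SU2\<^esub> n) \<otimes>\<^bsub>SU2\<^esub> inv\<^bsub>SU2\<^esub> (Y [^]\<^bsub>SU2\<^esub> m)"
        using arg_cong[OF comm, of "\<lambda>x. inv\<^bsub>SU2\<^esub> x"] by simp
      ultimately have "word_map_surjective SU2
          (commutator F2 (commutator F2 a_F2 b_F2)
             ((a_F2 [^]\<^bsub>F2\<^esub> n \<otimes>\<^bsub>F2\<^esub> b_F2 [^]\<^bsub>F2\<^esub> m) \<otimes>\<^bsub>F2\<^esub> commutator F2 a_F2 b_F2 \<otimes>\<^bsub>F2\<^esub> (b_F2 [^]\<^bsub>F2\<^esub> (- m) \<otimes>\<^bsub>F2\<^esub> a_F2 [^]\<^bsub>F2\<^esub> (- n))))"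
        using z by (intro commutator_conj_word_surjective[where x = X and y = Y,
              OF _ _ _ _ _ _ _ _ C[symmetric] com]) simp_all
      then show ?thesis by (simp add: F2.m_assoc)
    qed
    show "word_map_surjective SU2
          (commutator F2 (commutator F2 a_F2 b_F2)
             (a_F2 [^]\<^bsub>F2\<^esub> n \<otimes>\<^bsub>F2\<^esub> b_F2 [^]\<^bsub>F2\<^esub> (2::int) \<otimes>\<^bsub>F2\<^esub> commutator F2 a_F2 b_F2 \<otimes>\<^bsub>F2\<^esub> b_F2 [^]\<^bsub>F2\<^esub> (- 2::int) \<otimes>\<^bsub>F2\<^esub> a_F2 [^]\<^bsub>F2\<^esub> (- n)))"
      by (rule even_case) simp
    note even_case
  }
  note even_case = this
  show "word_map_surjective SU2
          (commutator F2 (commutator F2 a_F2 b_F2)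
             (a_F2 [^]\<^bsub>F2\<^esub> n \<otimes>\<^bsub>F2\<^esub> b_F2 [^]\<^bsub>F2\<^esub> m \<otimes>\<^bsub>F2\<^esub> commutator F2 a_F2 b_F2 \<otimes>\<^bsub>F2\<^esub> b_F2 [^]\<^bsub>F2\<^esub> (- m) \<otimes>\<^bsub>F2\<^esub> a_F2 [^]\<^bsub>F2\<^esub> (- n)))"
    if "n \<ge> 2 \<and> m \<ge> 2 \<and> n mod 6 \<in> {1, 2, 4, 5} \<and> m mod 4 \<in> {0, 2}" for m :: int
  proof -
    have "even m" using that by (auto simp: even_iff_mod_2_eq_zero) presburger+
    then show ?thesis using even_case that by simp
  qed
  assume n: "n \<ge> 2"
  show "word_map_surjective SU2
          (commutator F2 (commutator F2 a_F2 b_F2)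
             (a_F2 [^]\<^bsub>F2\<^esub> n \<otimes>\<^bsub>F2\<^esub> b_F2 \<otimes>\<^bsub>F2\<^esub> commutator F2 a_F2 b_F2 \<otimes>\<^bsub>F2\<^esub> inv\<^bsub>F2\<^esub> b_F2 \<otimes>\<^bsub>F2\<^esub> a_F2 [^]\<^bsub>F2\<^esub> (- n)))"
  proof -
    obtain X Y C where XY [simp]: "X \<in> carrier SU2" "Y \<in> carrier SU2" and Y: "Y \<otimes>\<^bsub>SU2\<^esub> Y = quat (-1) 0"
      and C: "C = commutator SU2 X Y"
      and com1: "commutator SU2 C (X [^]\<^bsub>SU2\<^esub> (1::int) \<otimes>\<^bsub>SU2\<^esub> C \<otimes>\<^bsub>SU2\<^esub> inv\<^bsub>SU2\<^esub> (X [^]\<^bsub>SU2\<^esub> (1::int))) = quat (-1) 0"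
      using exists_pair_square_minus_one[of 1] by auto
    have com: "commutator SU2 C (X \<otimes>\<^bsub>SU2\<^esub> C \<otimes>\<^bsub>SU2\<^esub> inv\<^bsub>SU2\<^esub> X) = quat (-1) 0"
      using com1 by (simp del: SU2.m_assoc)
    have CG: "C \<in> carrier SU2" by (simp add: C)
    have "word_map_surjective SU2
          (commutator F2 (commutator F2 a_F2 b_F2)
             ((a_F2 [^]\<^bsub>F2\<^esub> n \<otimes>\<^bsub>F2\<^esub> b_F2) \<otimes>\<^bsub>F2\<^esub> commutator F2 a_F2 b_F2 \<otimes>\<^bsub>F2\<^esub> (inv\<^bsub>F2\<^esub> b_F2 \<otimes>\<^bsub>F2\<^esub> a_F2 [^]\<^bsub>F2\<^esub> (- n))))"
    proof (cases "even n")
      case True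
      \<comment> \<open>With \<open>a = Y\<close> and \<open>b = X\<close> the conjugating element is \<open>\<plusminus>X\<close>.\<close>
      from True have "Y [^]\<^bsub>SU2\<^esub> n \<in> {\<one>\<^bsub>SU2\<^esub>, quat (-1) 0}" using even_pow XY(2) Y by blast
      then show ?thesis
        by (intro commutator_conj_word_surjective[where x = Y and y = X,
            OF _ _ _ _ _ _ _ _ _ inv[OF CG _ com]]) (simp_all add: C SU2.inv_commutator del: SU2.m_assoc)
    next
      case False
      \<comment> \<open>With \<open>a = Y\<^sup>-\<^sup>1\<close> and \<open>b = YX\<close> the conjugating element is \<open>\<plusminus>ab = \<plusminus>X\<close>.\<close>
      have "inv\<^bsub>SU2\<^esub> Y \<otimes>\<^bsub>SU2\<^esub> inv\<^bsub>SU2\<^esub> Y = quat (-1) 0"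
        using arg_cong[OF Y, of "\<lambda>x. inv\<^bsub>SU2\<^esub> x"] SU2.involution_inv[OF central_involution_minus_one] by simp
      then have "inv\<^bsub>SU2\<^esub> Y [^]\<^bsub>SU2\<^esub> (n - 1) \<in> {\<one>\<^bsub>SU2\<^esub>, quat (-1) 0}"
        using even_pow[of "inv\<^bsub>SU2\<^esub> Y" "n - 1"] XY(2) False by simp
      moreover have "inv\<^bsub>SU2\<^esub> Y [^]\<^bsub>SU2\<^esub> n = inv\<^bsub>SU2\<^esub> Y [^]\<^bsub>SU2\<^esub> (n - 1) \<otimes>\<^bsub>SU2\<^esub> inv\<^bsub>SU2\<^esub> Y"
        using SU2.int_pow_mult[of "inv\<^bsub>SU2\<^esub> Y" "n - 1" 1] by simp
      ultimately show ?thesis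
        by (intro commutator_conj_word_surjective[where x = "inv\<^bsub>SU2\<^esub> Y" and y = "Y \<otimes>\<^bsub>SU2\<^esub> X" and z = "inv\<^bsub>SU2\<^esub> Y [^]\<^bsub>SU2\<^esub> (n - 1)",
            OF _ _ _ _ _ _ _ _ _ com]) (simp_all add: C SU2.commutator_inv_mult)
    qed
    then show ?thesis by (simp add: F2.m_assoc)
  qed
  show "word_map_surjective SU2
          (commutator F2 (commutator F2 a_F2 b_F2)
             (commutator F2 a_F2 ((a_F2 \<otimes>\<^bsub>F2\<^esub> b_F2) [^]\<^bsub>F2\<^esub> n)))"
  proof -
    obtain k where k: "n = int k" "k \<ge> 2" using n by (cases n) auto
    obtain X Y C where XY [simp]: "X \<in> carrier SU2" "Y \<in> carrier SU2"
      and Y: "Y [^]\<^bsub>SU2\<^esub> Suc k \<in> {\<one>\<^bsub>SU2\<^esub>, quat (-1) 0}"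
      and C: "C = commutator SU2 X Y"
      and com: "commutator SU2 C (X \<otimes>\<^bsub>SU2\<^esub> C \<otimes>\<^bsub>SU2\<^esub> inv\<^bsub>SU2\<^esub> X) = quat (-1) 0"
      using exists_pair_power_central[OF k(2)] by metis
    have CG: "C \<in> carrier SU2" by (simp add: C)
    \<comment> \<open>The values substituted for \<open>a\<close> and \<open>b\<close> are \<open>Y X\<^sup>-\<^sup>1\<close> and \<open>X\<close>, so that \<open>ab\<close> takes the value \<open>Y\<close>.\<close>
    define a where "a = Y \<otimes>\<^bsub>SU2\<^esub> inv\<^bsub>SU2\<^esub> X"
    have a: "a \<in> carrier SU2" "a \<otimes>\<^bsub>SU2\<^esub> X = Y" by (simp_all add: a_def)
    have pow: "Y [^]\<^bsub>SU2\<^esub> n = Y [^]\<^bsub>SU2\<^esub> Suc k \<otimes>\<^bsub>SU2\<^esub> inv\<^bsub>SU2\<^esub> Y"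
      by (simp add: k int_pow_int)
    have "commutator SU2 a (Y [^]\<^bsub>SU2\<^esub> n) = commutator SU2 a (inv\<^bsub>SU2\<^esub> Y)"
      unfolding pow using a(1)
      by (intro SU2.commutator_mult_central SU2.central_one_involution[OF central_involution_minus_one Y]) simp_all
    also have "\<dots> = inv\<^bsub>SU2\<^esub> X \<otimes>\<^bsub>SU2\<^esub> C \<otimes>\<^bsub>SU2\<^esub> X"
      by (simp add: a_def C commutator_def)
    finally have D: "commutator SU2 a (Y [^]\<^bsub>SU2\<^esub> n) = inv\<^bsub>SU2\<^esub> X \<otimes>\<^bsub>SU2\<^esub> C \<otimes>\<^bsub>SU2\<^esub> X" .
    have "commutator SU2 a X = inv\<^bsub>SU2\<^esub> C"
      by (simp add: a_def C commutator_def)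
    then show ?thesis
      using SU2.commutator_inv_conj_involution[OF central_involution_minus_one CG XY(1) com] D a
      by (intro word_map_surjective_if_minus_one[of a X]) (simp_all del: SU2.m_assoc)
  qed
qed

end
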